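(* There is no social reputation rule for positive reputation system settings that satisfies all three of the postulates Generality (G), Transitivity (T) and Weak Monotonicity (M).
   Context: A positive reputation system setting is a finite directed graph $G=(V,E)$ without self-loops, where $V$ is the set of agents and $E\subseteq V^2$ is the set of positive feedbacks ($(u,v)\in E$ means that $u$ gives positive feedback on $v$). For $v\in V$ let $R(v)=\{u\in V:(u,v)\in E\}$. A social ranking of $G$ is a function $S(G):V\to\{1,\dots,|V|\}$ (not necessarily injective). Write $v_i\ge v_j$ if $S(G)(v_i)\le S(G)(v_j)$ (so a smaller number means ranked higher), and $v_i>v_j$ if $v_i\ge v_j$ but not $v_j\ge v_i$. As usual $v\le w$ means $w\ge v$, and $v<w$ means $w>v$. A social reputation rule $S$ assigns to each positive reputation system setting $G$ in some nonempty class of settings (its domain) a social ranking $S(G)$ of the nodes of $G$. Given $G$ and $S(G)$, $R(v_i)$ is more important than $R(v_j)$ if there is an injective map $f:R(v_j)\to R(v_i)$ such that $v\le f(v)$ for every $v\in R(v_j)$, and either $f$ is not onto or there is at least one $v\in R(v_j)$ with $v<f(v)$. Postulates for a rule $S$: - Generality (G): $S$ is defined on every positive reputation system setting. - Transitivity (T): for every $G=(V,E)$ in the domain of $S$, with respect to $S(G)$: for all $v_i,v_j\in V$, if $R(v_i)$ is more important than $R(v_j)$ then $v_i>v_j$. - Weak Monotonicity (M): for every $G=(V,E)$ in the domain of $S$, with respect to $S(G)$: for all $v_i,v_j\in V$, if $R(v_i)$ is not more important than $R(v_j)$ but $v_i>v_j$, then there exist $v_1\in R(v_i)$ and $v_2\in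 R(v_j)$ such that $v_1>v_2$. *)

theory Defs
  imports "Graph_Theory.Pair_Digraph" "HOL-Library.FuncSet"
begin

text \<open>
  A positive reputation system setting is a finite directed graph without self-loops and
  without parallel arcs, i.e. a \<^term>\<open>pair_digraph\<close>.  Agents are drawn from the type
  \<^typ>\<open>'a\<close>, and the vertex set of a setting is an arbitrary finite subset of it.
  If the type is infinite, every finite digraph occurs up to isomorphism.
\<close>

definition reputation_settings :: "'a pair_pre_digraph set" where
  "reputation_settings = {G. pair_digraph G}"

definition raters :: "'a pair_pre_digraph \<Rightarrow> 'a \<Rightarrow> 'a set" where
  "raters G v = {u \<in> pverts G. (u, v) \<in> parcs G}"

definition social_rankings :: "'a pair_pre_digraph \<Rightarrow> ('a \<Rightarrow> nat) set" where
  "social_rankings G = pverts G \<rightarrow>\<^sub>E {1..card (pverts G)}"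

text \<open>Rank 1 is the top position, so a smaller number means a higher rank.\<close>

definition ranked_ge :: "('a \<Rightarrow> nat) \<Rightarrow> 'a \<Rightarrow> 'a \<Rightarrow> bool" where
  "ranked_ge r v w \<longleftrightarrow> r v \<le> r w"

definition ranked_gt :: "('a \<Rightarrow> nat) \<Rightarrow> 'a \<Rightarrow> 'a \<Rightarrow> bool" where
  "ranked_gt r v w \<longleftrightarrow> ranked_ge r v w \<and> \<not> ranked_ge r w v"

definition more_important :: "'a pair_pre_digraph \<Rightarrow> ('a \<Rightarrow> nat) \<Rightarrow> 'a \<Rightarrow> 'a \<Rightarrow> bool" where
  "more_important G r v w \<longleftrightarrow>
     (\<exists>f. f \<in> raters G w \<rightarrow> raters G v \<and> inj_on f (raters G w) \<and>
          (\<forall>u \<in> raters G w. ranked_ge r (f u) u) \<and>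
          (f ` raters G w \<noteq> raters G v \<or> (\<exists>u \<in> raters G w. ranked_gt r (f u) u)))"

text \<open>
  A rule is a partial function from settings to rankings; its domain \<^term>\<open>dom S\<close> is the class
  of settings on which it is defined.
\<close>

type_synonym 'a rule = "'a pair_pre_digraph \<rightharpoonup> ('a \<Rightarrow> nat)"

definition social_reputation_rule :: "'a rule \<Rightarrow> bool" where
  "social_reputation_rule S \<longleftrightarrow>
     dom S \<noteq> {} \<and> dom S \<subseteq> reputation_settings \<and>
     (\<forall>G r. S G = Some r \<longrightarrow> r \<in> social_rankings G)"

definition generality :: "'a rule \<Rightarrow> bool" where
  "generality S \<longleftrightarrow> reputation_settings \<subseteq> dom S"

definition transitivity :: "'a rule \<Rightarrow> bool" where
  "transitivity S \<longleftrightarrow>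
     (\<forall>G r. S G = Some r \<longrightarrow>
       (\<forall>v \<in> pverts G. \<forall>w \<in> pverts G. more_important G r v w \<longrightarrow> ranked_gt r v w))"

definition weak_monotonicity :: "'a rule \<Rightarrow> bool" where
  "weak_monotonicity S \<longleftrightarrow>
     (\<forall>G r. S G = Some r \<longrightarrow>
       (\<forall>v \<in> pverts G. \<forall>w \<in> pverts G.
          \<not> more_important G r v w \<and> ranked_gt r v w \<longrightarrow>
            (\<exists>v' \<in> raters G v. \<exists>w' \<in> raters G w. ranked_gt r v' w')))"

end

theory Submission
  imports Defs
begin

text \<open>
  Let \<open>a\<close> and \<open>b\<close> rate each other and let an unrated agent \<open>c\<close> rate \<open>a\<close>.  By (T) agent \<open>a\<close>
  is ranked above \<open>c\<close>.  If \<open>b \<ge> a\<close>, then sending \<open>a\<close> to \<open>b\<close> shows that \<open>R(a) = {b, c}\<close> is more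
  important than \<open>R(b) = {a}\<close>, so \<open>a > b\<close> by (T).  Hence \<open>a > b\<close>, so \<open>a\<close> lies strictly above every
  element of \<open>R(a)\<close>.  So \<open>R(a)\<close> is not more important than \<open>R(b)\<close>, and (M) fails for \<open>a > b\<close>.
\<close>

text \<open>On an empty set of raters every map is vacuously injective, and its empty image is not
  all of \<open>raters G v\<close>.\<close>

lemma more_important_if_unrated:
  assumes "raters G w = {}" and "raters G v \<noteq> {}"
  shows "more_important G r v w"
  using assms unfolding more_important_def by auto

theorem theorem1:
  assumes "infinite (UNIV :: 'a set)"
  shows "\<not> (\<exists>S :: 'a rule. social_reputation_rule S \<and>
              generality S \<and> transitivity S \<and> weak_monotonicity S)"
proof
  assume "\<exists>S :: 'a rule. social_reputation_rule S \<and>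
              generality S \<and> transitivity S \<and> weak_monotonicity S"
  then obtain S :: "'a rule"
    where gen: "generality S" and trans: "transitivity S" and mono: "weak_monotonicity S"
    by blast
  obtain A :: "'a set" where "card A = 3"
    using infinite_arbitrarily_large[OF assms] by blast
  then obtain a b c :: 'a where ne: "a \<noteq> b" "a \<noteq> c" "b \<noteq> c"
    by (auto simp: card_3_iff)
  define G where "G = \<lparr>pverts = {a, b, c}, parcs = {(a, b), (b, a), (c, a)}\<rparr>"
  have "pair_digraph G"
    using ne by unfold_locales (auto simp: G_def)
  then obtain r where r: "S G = Some r"
    using gen by (auto simp: generality_def reputation_settings_def)
  have verts: "a \<in> pverts G" "b \<in> pverts G" "c \<in> pverts G"
    by (auto simp: G_def)
  have raters: "raters G a = {b, c}" "raters G b = {a}" "raters G c = {}"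
    using ne by (auto simp: G_def raters_def)
  have T: "r v < r w" if "v \<in> pverts G" "w \<in> pverts G" "more_important G r v w" for v w
    using trans r that unfolding transitivity_def ranked_gt_def ranked_ge_def not_le by blast
  have "r a < r c"
    using T verts raters by (simp add: more_important_if_unrated)
  have "r a < r b"
  proof (rule ccontr)
    assume "\<not> r a < r b"
    \<comment> \<open>The constant map is injective because \<open>a\<close> alone rates
      \<open>b\<close>, and it is not onto because it misses \<open>c\<close>.\<close>
    then have "more_important G r a b"
      using ne raters by (auto simp: more_important_def ranked_ge_def intro!: exI[of _ "\<lambda>_. b"])
    then show False
      using T verts \<open>\<not> r a < r b\<close> by blast
  qed
  \<comment> \<open>A witness would have to send \<open>a\<close> to \<open>b\<close> or
    \<open>c\<close>, both ranked strictly below \<open>a\<close>.\<close>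
  have "\<not> more_important G r a b"
    using \<open>r a < r b\<close> \<open>r a < r c\<close> raters by (auto simp: more_important_def ranked_ge_def)
  \<comment> \<open>Here \<open>w\<close> can only be \<open>a\<close>, and \<open>v\<close> is
    \<open>b\<close> or \<open>c\<close>.\<close>
  then obtain v w where "v \<in> raters G a" "w \<in> raters G b" "ranked_gt r v w"
    using mono r verts \<open>r a < r b\<close>
    unfolding weak_monotonicity_def ranked_gt_def ranked_ge_def by fastforce
  then show False
    using \<open>r a < r b\<close> \<open>r a < r c\<close> raters by (auto simp: ranked_gt_def ranked_ge_def)
qed

end
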